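(* For every countable finite-by-abelian group $G$, $g(G)<\omega$; i.e. $G$ is generated by finitely many abelian subgroups.
   Context: A group $G$ is finite-by-abelian if its derived subgroup $G'$ is finite. For a group $G$, $g(G)$ denotes the minimum number of abelian subgroups of $G$ needed to generate $G$. *)

theory Defs
  imports "HOL-Algebra.Generated_Groups" "HOL-Library.Countable_Set"
begin

unbundle cardinal_syntax

definition finite_by_abelian :: "('a, 'b) monoid_scheme \<Rightarrow> bool" where
  "finite_by_abelian G \<longleftrightarrow> group G \<and> finite (derived G (carrier G))"

definition abelian_subgroup :: "'a set \<Rightarrow> ('a, 'b) monoid_scheme \<Rightarrow> bool" where
  "abelian_subgroup A G \<longleftrightarrow> subgroup A G \<and> comm_group (G\<lparr>carrier := A\<rparr>)"

definition abelian_generating :: "('a, 'b) monoid_scheme \<Rightarrow> 'a set set \<Rightarrow> bool" where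
  "abelian_generating G \<A> \<longleftrightarrow>
     (\<forall>A\<in>\<A>. abelian_subgroup A G) \<and> generate G (\<Union>\<A>) = carrier G"

text \<open>
  The number \<open>g(G)\<close> is in general an infinite cardinal, so it is represented by a cardinal in the
  sense of the BNF cardinal theories: \<open>|\<A>|\<close> for a generating family \<open>\<A>\<close> of least cardinality.
  It is determined up to \<open>=o\<close> only, and is to be compared with \<open>\<omega>\<close>, i.e. \<^const>\<open>natLeq\<close>.
\<close>

definition ab_gen_number :: "('a, 'b) monoid_scheme \<Rightarrow> 'a set rel" where
  "ab_gen_number G =
     |SOME \<A>. abelian_generating G \<A> \<and> (\<forall>\<B>. abelian_generating G \<B> \<longrightarrow> |\<A>| \<le>o |\<B>| )|"

text \<open>The minimum exists: \<open>G\<close> is generated by its cyclic subgroups.\<close>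

lemma (in group) abelian_generating_cyclic:
  "abelian_generating G ((\<lambda>x. generate G {x}) ` carrier G)"
proof -
  have ab: "abelian_subgroup (generate G {x}) G" if x: "x \<in> carrier G" for x
  proof -
    have sub: "subgroup (generate G {x}) G"
      using x by (simp add: generate_is_subgroup)
    have comm: "a \<otimes> b = b \<otimes> a" if ab: "a \<in> generate G {x}" "b \<in> generate G {x}" for a b
    proof -
      obtain i j :: int where "a = x [^] i" "b = x [^] j"
        using ab x by (auto simp: generate_pow)
      then show ?thesis
        using x by (simp add: int_pow_mult [symmetric] add.commute)
    qed
    interpret H: group "G\<lparr>carrier := generate G {x}\<rparr>"
      by (rule subgroup_imp_group [OF sub])
    have "comm_group (G\<lparr>carrier := generate G {x}\<rparr>)"
      by (rule H.group_comm_groupI) (simp add: comm)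
    with sub show ?thesis
      by (simp add: abelian_subgroup_def)
  qed
  let ?U = "\<Union> ((\<lambda>x. generate G {x}) ` carrier G)"
  have "?U \<subseteq> carrier G"
    using generate_incl by blast
  moreover have "carrier G \<subseteq> ?U"
    by (auto intro: generate.incl)
  ultimately have U: "?U = carrier G"
    by blast
  have "generate G (carrier G) = carrier G"
    using generate_incl [of "carrier G"] by (auto intro: generate.incl)
  then show ?thesis
    unfolding abelian_generating_def U using ab by blast
qed

lemma (in group) ab_gen_number_attained:
  obtains \<A> where "abelian_generating G \<A>" "ab_gen_number G = |\<A>|"
    "\<And>\<B>. abelian_generating G \<B> \<Longrightarrow> |\<A>| \<le>o |\<B>|"
proof -
  have "\<exists>r \<in> card_of ` Collect (abelian_generating G).
      \<forall>r' \<in> card_of ` Collect (abelian_generating G). r \<le>o r'"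
    using abelian_generating_cyclic by (intro exists_minim_Card_order) (auto simp: card_of_Card_order)
  then have "\<exists>\<A>. abelian_generating G \<A> \<and> (\<forall>\<B>. abelian_generating G \<B> \<longrightarrow> |\<A>| \<le>o |\<B>| )"
    by auto
  from someI_ex [OF this] show thesis
    by (intro that) (auto simp: ab_gen_number_def)
qed

end

theory Submission
  imports Defs
begin

text \<open>
  The centralizer \<open>C\<close> of the finite group \<open>G'\<close> has finite index, so \<open>G\<close> is generated by \<open>C\<close> and finitely
  many cyclic subgroups, and the commutators of \<open>C\<close> lie in the finite central subgroup \<open>M = G' \<inter> C\<close>.
  Let \<open>N\<close> be a maximal proper subgroup of \<open>M\<close>. The commutator modulo \<open>N\<close> is an alternating form on \<open>C\<close>
  with values in a group of prime order; since \<open>C\<close> is countable, hyperbolic pairs can be split off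
  one after the other (as in the construction of a symplectic basis), and collecting the first and the
  second members of the pairs shows that \<open>C\<close> is generated by two subgroups whose commutators lie
  in \<open>N\<close>. Induction on \<open>|M|\<close> then yields abelian subgroups.
\<close>

section \<open>Commutators and generated subgroups\<close>

definition (in group) commutator :: "'a \<Rightarrow> 'a \<Rightarrow> 'a" where
  "commutator x y = x \<otimes> y \<otimes> inv x \<otimes> inv y"

lemma (in group) mult_inv_cancel [simp]:
  assumes "x \<in> carrier G" "y \<in> carrier G"
  shows "x \<otimes> (inv x \<otimes> y) = y" "inv x \<otimes> (x \<otimes> y) = y"
  using assms by (simp_all flip: m_assoc)

lemma (in group) commutator_closed [simp]:
  "x \<in> carrier G \<Longrightarrow> y \<in> carrier G \<Longrightarrow> commutator x y \<in> carrier G"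
  by (simp add: commutator_def)

lemma (in group) commutator_mult_eq:
  assumes "x \<in> carrier G" "y \<in> carrier G"
  shows "x \<otimes> y = commutator x y \<otimes> (y \<otimes> x)"
  using assms by (simp add: commutator_def m_assoc)

lemma (in group) commutator_eq_one_iff:
  assumes "x \<in> carrier G" "y \<in> carrier G"
  shows "commutator x y = \<one> \<longleftrightarrow> x \<otimes> y = y \<otimes> x"
  using assms commutator_mult_eq [OF assms]
  by (metis commutator_closed l_one m_closed r_cancel_one)

lemma (in group) inv_commutator:
  assumes "x \<in> carrier G" "y \<in> carrier G"
  shows "inv (commutator x y) = commutator y x"
  using assms by (simp add: commutator_def m_assoc inv_mult_group)

lemma (in group) generate_subset_subgroup:
  "subgroup K G \<Longrightarrow> S \<subseteq> K \<Longrightarrow> generate G S \<subseteq> K"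
  using generate_subgroup_incl by blast

lemma (in group) abelian_subgroupI:
  assumes "subgroup A G" "\<And>x y. x \<in> A \<Longrightarrow> y \<in> A \<Longrightarrow> x \<otimes> y = y \<otimes> x"
  shows "abelian_subgroup A G"
proof -
  interpret A: group "G\<lparr>carrier := A\<rparr>"
    by (rule subgroup_imp_group [OF assms(1)])
  have "comm_group (G\<lparr>carrier := A\<rparr>)"
    by (rule A.group_comm_groupI) (simp add: assms(2))
  with assms(1) show ?thesis
    by (simp add: abelian_subgroup_def)
qed

lemma (in group) generate_subgroup_transversal:
  assumes C: "subgroup C G" and T: "T \<subseteq> carrier G"
    and cover: "\<And>x. x \<in> carrier G \<Longrightarrow> \<exists>t\<in>T. inv t \<otimes> x \<in> C"
  shows "generate G (C \<union> T) = carrier G"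
proof
  have CT: "C \<union> T \<subseteq> carrier G"
    using T subgroup.subset [OF C] by blast
  show "generate G (C \<union> T) \<subseteq> carrier G"
    by (rule generate_incl [OF CT])
  show "carrier G \<subseteq> generate G (C \<union> T)"
  proof
    fix x assume x: "x \<in> carrier G"
    then obtain t where t: "t \<in> T" "inv t \<otimes> x \<in> C"
      using cover by blast
    then have "t \<otimes> (inv t \<otimes> x) \<in> generate G (C \<union> T)"
      by (blast intro: generate.eng generate.incl)
    then show "x \<in> generate G (C \<union> T)"
      using t x T by (simp add: subset_iff)
  qed
qed

locale central_commutators = group G for G (structure) +
  fixes H M
  assumes H: "subgroup H G" and M: "subgroup M G"
    and central: "\<And>m x. m \<in> M \<Longrightarrow> x \<in> H \<Longrightarrow> m \<otimes> x = x \<otimes> m"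
    and commutator_in: "\<And>x y. x \<in> H \<Longrightarrow> y \<in> H \<Longrightarrow> commutator x y \<in> M"
begin

lemma H_carrier [simp]: "x \<in> H \<Longrightarrow> x \<in> carrier G"
  using subgroup.mem_carrier [OF H] .

lemmas H_closed [simp] =
  subgroup.m_closed [OF H] subgroup.m_inv_closed [OF H] subgroup.one_closed [OF H]

text \<open>In any group \<open>commutator (x \<otimes> y) z\<close> is the conjugate of
  \<open>commutator y z\<close> by \<open>x\<close>, times \<open>commutator x z\<close>. Here the
  conjugation is trivial because \<open>M\<close> commutes with \<open>H\<close>.\<close>

lemma commutator_mult_left:
  assumes "x \<in> H" "y \<in> H" "z \<in> H"
  shows "commutator (x \<otimes> y) z = commutator x z \<otimes> commutator y z"
proof -
  have "commutator (x \<otimes> y) z = x \<otimes> commutator y z \<otimes> (z \<otimes> inv x \<otimes> inv z)"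
    using assms by (simp add: commutator_def m_assoc inv_mult_group)
  also have "x \<otimes> commutator y z = commutator y z \<otimes> x"
    using central commutator_in assms by simp
  also have "commutator y z \<otimes> x \<otimes> (z \<otimes> inv x \<otimes> inv z) = commutator y z \<otimes> commutator x z"
    using assms by (simp add: commutator_def m_assoc)
  also have "\<dots> = commutator x z \<otimes> commutator y z"
  proof -
    \<comment> \<open>To swap the two values, one is viewed as an element of \<open>M\<close> and
      the other as an element of \<open>H\<close>.\<close>
    have "commutator x z \<in> H" using assms by (simp add: commutator_def)
    then show ?thesis using central commutator_in assms by simp
  qed
  finally show ?thesis .
qed

lemma commutator_int_pow_left:
  assumes "x \<in> H" "z \<in> H"
  shows "commutator (x [^] (k::int)) z = commutator x z [^] k"
proof -
  interpret HG: group "G\<lparr>carrier := H\<rparr>"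
    by (rule subgroup_imp_group [OF H])
  \<comment> \<open>With \<open>z\<close> fixed, the commutator is a homomorphism from
    \<open>H\<close> to \<open>G\<close>, which settles negative exponents as well.\<close>
  interpret group_hom "G\<lparr>carrier := H\<rparr>" G "\<lambda>x. commutator x z"
    by unfold_locales (auto simp: hom_def commutator_mult_left assms)
  show ?thesis
    using hom_int_pow [of x k] assms by (simp add: int_pow_consistent [OF H, symmetric])
qed

end

text \<open>
  The last assumption is a quotient-free way to say that \<open>M / N\<close> has prime order (or is trivial): every
  element outside \<open>N\<close> generates it.
\<close>

locale maximal_central_commutators = central_commutators +
  fixes N
  assumes N: "subgroup N G" "N \<subseteq> M"
    and maximal: "\<And>u v. u \<in> M \<Longrightarrow> u \<notin> N \<Longrightarrow> v \<in> M \<Longrightarrow> \<exists>k::int. v \<otimes> u [^] k \<in> N"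
begin

section \<open>Orthogonality for the commutator form modulo \<open>N\<close>\<close>

definition ortho :: "'a \<Rightarrow> 'a \<Rightarrow> bool" where
  "ortho x y \<longleftrightarrow> commutator x y \<in> N"

lemmas N_closed [simp] =
  subgroup.m_closed [OF N(1)] subgroup.m_inv_closed [OF N(1)] subgroup.one_closed [OF N(1)]

lemma ortho_sym: "x \<in> H \<Longrightarrow> y \<in> H \<Longrightarrow> ortho x y \<Longrightarrow> ortho y x"
  unfolding ortho_def by (metis H_carrier N_closed(2) inv_commutator)

lemma ortho_refl [simp]: "x \<in> H \<Longrightarrow> ortho x x"
  by (simp add: ortho_def commutator_eq_one_iff [THEN iffD2])

lemma subgroup_ortho:
  assumes "y \<in> H"
  shows "subgroup {x \<in> H. ortho x y} G"
proof
  show "inv x \<in> {x \<in> H. ortho x y}" if "x \<in> {x \<in> H. ortho x y}" for x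
    using that assms commutator_int_pow_left [of x y "-1"]
    by (simp add: ortho_def int_pow_neg)
qed (use assms in \<open>auto simp: ortho_def commutator_mult_left commutator_eq_one_iff [THEN iffD2]\<close>)

lemma subgroup_ortho_all:
  assumes "S \<subseteq> H"
  shows "subgroup {x \<in> H. \<forall>y\<in>S. ortho x y} G"
proof -
  \<comment> \<open>Inserting \<open>H\<close> makes the intersection correct for empty
    \<open>S\<close> too.\<close>
  have "{x \<in> H. \<forall>y\<in>S. ortho x y} = \<Inter> (insert H ((\<lambda>y. {x \<in> H. ortho x y}) ` S))"
    by auto
  also have "subgroup \<dots> G"
    using assms by (intro subgroups_Inter) (auto simp: H intro: subgroup_ortho)
  finally show ?thesis .
qed

text \<open>Orthogonal complements are subgroups, so the relation passes from \<open>S\<close> to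
  its span in one argument at a time. Symmetry exchanges the arguments between the two
  passes.\<close>

lemma ortho_generate:
  assumes "S \<subseteq> H" "\<And>x y. x \<in> S \<Longrightarrow> y \<in> S \<Longrightarrow> ortho x y"
    and "x \<in> generate G S" "y \<in> generate G S"
  shows "ortho x y"
proof -
  have 1: "generate G S \<subseteq> {x \<in> H. \<forall>y\<in>S. ortho x y}"
    using assms(1,2) by (intro generate_subset_subgroup subgroup_ortho_all) (auto simp: H)
  then have "generate G S \<subseteq> {x \<in> H. \<forall>y\<in>generate G S. ortho x y}"
    using assms(1,2) by (intro generate_subset_subgroup subgroup_ortho_all) (auto simp: H intro: ortho_sym)
  then show ?thesis
    using assms(3,4) by blast
qed

text \<open>The projection step of Gram-Schmidt: \<open>commutator u z\<close> lies outside
  \<open>N\<close> and so generates \<open>M\<close> modulo \<open>N\<close>, hence one of its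
  powers cancels \<open>commutator x z\<close>.\<close>

lemma ortho_correction:
  assumes "x \<in> H" "u \<in> H" "z \<in> H" "\<not> ortho u z"
  obtains k :: int where "ortho (u [^] k \<otimes> x) z"
proof -
  obtain k :: int where k: "commutator x z \<otimes> commutator u z [^] k \<in> N"
    using maximal assms commutator_in unfolding ortho_def by meson
  \<comment> \<open>\<open>maximal\<close> yields the power as the right factor, whereas expanding
    the commutator of \<open>u [^] k \<otimes> x\<close> puts it on the left.\<close>
  have "commutator u z [^] k \<in> M"
    using assms commutator_in by (simp add: subgroup_int_pow_closed [OF M])
  moreover have "commutator x z \<in> H"
    using assms by (simp add: commutator_def)
  ultimately have "commutator u z [^] k \<otimes> commutator x z \<in> N"
    using k central by simp
  moreover have "u [^] k \<in> H"
    using assms(2) by (simp add: subgroup_int_pow_closed [OF H])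
  ultimately show thesis
    using assms by (intro that [of k]) (simp add: ortho_def commutator_mult_left commutator_int_pow_left)
qed

section \<open>Splitting off hyperbolic pairs\<close>

definition radical :: "'a set" where
  "radical = {z \<in> H. \<forall>x\<in>H. ortho z x}"

text \<open>
  The last conjunct, \<open>H = \<langle>A, B\<rangle> (A \<union> B)\<^sup>\<perp>\<close>, replaces non-degeneracy of the form on the span of \<open>A \<union> B\<close>;
  it makes the construction of hyperbolic pairs extendable.
\<close>

definition splitting :: "'a set \<Rightarrow> 'a set \<Rightarrow> bool" where
  "splitting A B \<longleftrightarrow> A \<subseteq> H \<and> B \<subseteq> H \<and>
     (\<forall>x\<in>A. \<forall>y\<in>A. ortho x y) \<and> (\<forall>x\<in>B. \<forall>y\<in>B. ortho x y) \<and>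
     (\<forall>x\<in>H. \<exists>s\<in>generate G (A \<union> B). \<exists>y\<in>H. x = s \<otimes> y \<and> (\<forall>z\<in>A \<union> B. ortho y z))"

text \<open>Here \<open>c\<close> and \<open>h\<close> form a new hyperbolic pair orthogonal to the
  old ones. The orthogonal part \<open>y\<close> of an element is corrected by a power of
  \<open>h\<close> to become orthogonal to \<open>c\<close>, then by a power of \<open>c\<close> to
  become orthogonal to \<open>h\<close>.\<close>

lemma splitting_insert:
  assumes spl: "splitting A B"
    and c: "c \<in> H" "\<forall>z\<in>A \<union> B. ortho c z" and h: "h \<in> H" "\<forall>z\<in>A \<union> B. ortho h z"
    and nch: "\<not> ortho c h"
  shows "splitting (insert c A) (insert h B)"
proof -
  let ?S = "A \<union> B" and ?T = "insert c A \<union> insert h B"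
  have S: "?S \<subseteq> H" and T: "?T \<subseteq> H"
    using spl c h by (auto simp: splitting_def)
  have pow: "c [^] k \<in> H" "h [^] k \<in> H" for k :: int
    using c h H by (auto simp: subgroup_int_pow_closed)
  have nhc: "\<not> ortho h c"
    using nch c h ortho_sym by blast
  have orth: "subgroup {x \<in> H. \<forall>y\<in>?S. ortho x y} G"
    by (rule subgroup_ortho_all [OF S])
  have sT: "subgroup (generate G ?T) G"
    using T by (intro generate_is_subgroup) auto
  have decomposition: "\<exists>s\<in>generate G ?T. \<exists>y\<in>H. x = s \<otimes> y \<and> (\<forall>z\<in>?T. ortho y z)" if x: "x \<in> H" for x
  proof -
    obtain s y where s: "s \<in> generate G ?S" and y: "y \<in> H" "x = s \<otimes> y" "\<forall>z\<in>?S. ortho y z"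
      using spl x unfolding splitting_def by blast
    obtain k :: int where k: "ortho (h [^] k \<otimes> y) c"
      using ortho_correction [OF y(1) h(1) c(1) nhc] .
    define y1 where "y1 = h [^] k \<otimes> y"
    have y1: "y1 \<in> H" using y pow by (simp add: y1_def)
    obtain l :: int where l: "ortho (c [^] l \<otimes> y1) h"
      using ortho_correction [OF y1 c(1) h(1) nch] .
    define y2 where "y2 = c [^] l \<otimes> y1"
    have y2: "y2 \<in> H" using y1 pow by (simp add: y2_def)
    \<comment> \<open>The second correction does not spoil the first: the form is alternating, so
      powers of \<open>c\<close> are orthogonal to \<open>c\<close>.\<close>
    have "c [^] l \<in> {x \<in> H. ortho x c}"
      by (rule subgroup_int_pow_closed [OF subgroup_ortho]) (use c in auto)
    then have "ortho y2 c"
      using subgroup.m_closed [OF subgroup_ortho [OF c(1)], of "c [^] l" y1] k y1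
      by (simp add: y1_def y2_def)
    moreover have "y2 \<in> {x \<in> H. \<forall>y\<in>?S. ortho x y}"
      unfolding y2_def y1_def
      by (intro subgroup.m_closed [OF orth] subgroup_int_pow_closed [OF orth]) (use y c h in auto)
    ultimately have perp: "\<forall>z\<in>?T. ortho y2 z"
      using l by (auto simp: y2_def)
    \<comment> \<open>\<open>w\<close> collects both corrections: \<open>y2 = w \<otimes> y\<close>,
      so \<open>inv w\<close> is absorbed into the span component.\<close>
    define w where "w = c [^] l \<otimes> h [^] k"
    have w: "w \<in> generate G ?T" unfolding w_def
      by (intro subgroup.m_closed [OF sT] subgroup_int_pow_closed [OF sT]) (auto intro: generate.incl)
    have "s \<in> generate G ?T"
      using s mono_generate [of ?S ?T] by blast
    with w have "s \<otimes> inv w \<in> generate G ?T"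
      by (intro subgroup.m_closed [OF sT] subgroup.m_inv_closed [OF sT])
    moreover have "x = s \<otimes> inv w \<otimes> y2"
    proof -
      have sc: "s \<in> carrier G"
        using s generate_subset_subgroup [OF H S] by auto
      have "y2 = w \<otimes> y" "w \<in> carrier G"
        using pow y by (auto simp: y2_def y1_def w_def m_assoc)
      with sc y show ?thesis by (simp add: m_assoc inv_solve_left)
    qed
    ultimately show ?thesis using y2 perp by blast
  qed
  have "\<forall>x\<in>insert c A. \<forall>y\<in>insert c A. ortho x y" "\<forall>x\<in>insert h B. \<forall>y\<in>insert h B. ortho x y"
    using spl c h by (auto simp: splitting_def intro: ortho_sym)
  then show ?thesis
    using T decomposition unfolding splitting_def by blast
qed

text \<open>Only the component \<open>y\<close> of \<open>g\<close> orthogonal to the pairs has to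
  be captured. If it is not in the radical, it becomes the first member of a new pair.\<close>

lemma splitting_extend:
  assumes spl: "splitting A B" and g: "g \<in> H"
  obtains A' B' where "splitting A' B'" "A \<subseteq> A'" "B \<subseteq> B'" "g \<in> generate G (A' \<union> B' \<union> radical)"
proof -
  let ?S = "A \<union> B"
  have S: "?S \<subseteq> H"
    using spl by (auto simp: splitting_def)
  obtain s y where s: "s \<in> generate G ?S" and y: "y \<in> H" "g = s \<otimes> y" "\<forall>z\<in>?S. ortho y z"
    using spl g unfolding splitting_def by blast
  have mult: "g \<in> generate G U" if "?S \<subseteq> U" "y \<in> U" for U
    using s y that mono_generate [of ?S U] by (auto intro: generate.eng generate.incl)
  show thesis
  proof (cases "y \<in> radical")
    case True
    then show thesis
      using spl mult [of "?S \<union> radical"] by (intro that [of A B]) auto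
  next
    case False
    then obtain h0 where h0: "h0 \<in> H" "\<not> ortho y h0"
      using y by (auto simp: radical_def)
    \<comment> \<open>The partner of \<open>y\<close> must be orthogonal to the old pairs, so
      \<open>h0\<close> is replaced by its orthogonal component \<open>h\<close>. The removed factor
      \<open>t\<close> is orthogonal to \<open>y\<close>, hence \<open>h\<close> is still not
      orthogonal to \<open>y\<close>.\<close>
    obtain t h where t: "t \<in> generate G ?S" and h: "h \<in> H" "h0 = t \<otimes> h" "\<forall>z\<in>?S. ortho h z"
      using spl h0 unfolding splitting_def by blast
    have "generate G ?S \<subseteq> {x \<in> H. ortho x y}"
      using S y by (intro generate_subset_subgroup subgroup_ortho) (auto intro: ortho_sym)
    then have "t \<in> {x \<in> H. ortho x y}"
      using t by blast
    then have "h0 \<in> {x \<in> H. ortho x y}" if "ortho h y"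
      unfolding h(2) by (intro subgroup.m_closed [OF subgroup_ortho [OF y(1)]]) (use that h in auto)
    then have "\<not> ortho y h"
      using h0 h(1) y(1) ortho_sym by blast
    then have "splitting (insert y A) (insert h B)"
      using spl y h by (intro splitting_insert)
    moreover have "g \<in> generate G (insert y A \<union> insert h B \<union> radical)"
      by (rule mult) auto
    ultimately show thesis
      by (intro that [of "insert y A" "insert h B"]) auto
  qed
qed

lemma splitting_empty: "splitting {} {}"
proof -
  have "\<exists>s\<in>generate G ({} \<union> {}). \<exists>y\<in>H. x = s \<otimes> y \<and> (\<forall>z\<in>{} \<union> {}. ortho y z)" if "x \<in> H" for x
    using that by (intro bexI [of _ \<one>] bexI [of _ x]) (auto intro: generate.one)
  then show ?thesis
    by (simp add: splitting_def)
qed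

text \<open>Along an enumeration of \<open>H\<close>, splittings are extended so that each element
  is eventually captured. In the limit the first members together with the radical generate
  \<open>A\<close>, and the second members generate \<open>B\<close>.\<close>

lemma generated_by_two_subgroups:
  assumes count: "countable H"
  obtains A B where "subgroup A G" "subgroup B G" "A \<subseteq> H" "B \<subseteq> H" "generate G (A \<union> B) = H"
    "\<And>x y. x \<in> A \<Longrightarrow> y \<in> A \<Longrightarrow> commutator x y \<in> N"
    "\<And>x y. x \<in> B \<Longrightarrow> y \<in> B \<Longrightarrow> commutator x y \<in> N"
proof -
  have "H \<noteq> {}"
    using H_closed(3) by blast
  then have range_H: "range (from_nat_into H) = H"
    using count by (rule range_from_nat_into)
  then have enum: "from_nat_into H n \<in> H" for n
    by blast
  \<comment> \<open>The element with index \<open>n\<close> is captured by the splitting at stage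
    \<open>Suc n\<close>, up to the radical.\<close>
  let ?next = "\<lambda>n P Q. fst P \<subseteq> fst Q \<and> snd P \<subseteq> snd Q \<and>
    from_nat_into H n \<in> generate G (fst Q \<union> snd Q \<union> radical)"
  have "\<exists>P. \<forall>n. splitting (fst (P n)) (snd (P n)) \<and> ?next n (P n) (P (Suc n))"
  proof (rule dependent_nat_choice [of "\<lambda>n P. splitting (fst P) (snd P)" ?next])
    show "\<exists>P. splitting (fst P) (snd P)"
      using splitting_empty by (intro exI [of _ "({}, {})"]) simp
    show "\<exists>Q. splitting (fst Q) (snd Q) \<and> ?next n P Q" if spl: "splitting (fst P) (snd P)" for P n
    proof -
      obtain A' B' where "splitting A' B'" "fst P \<subseteq> A'" "snd P \<subseteq> B'"
        "from_nat_into H n \<in> generate G (A' \<union> B' \<union> radical)"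
        using splitting_extend [OF spl enum] .
      then show ?thesis
        by (intro exI [of _ "(A', B')"]) simp
    qed
  qed
  then obtain P where P: "\<And>n. splitting (fst (P n)) (snd (P n))" "\<And>n. ?next n (P n) (P (Suc n))"
    by blast
  define A where "A n = fst (P n)" for n
  define B where "B n = snd (P n)" for n
  have spl: "splitting (A n) (B n)" for n
    using P(1) [of n] by (simp add: A_def B_def)
  have spl_sub: "A n \<subseteq> H" "B n \<subseteq> H"
    and spl_ortho: "x \<in> A n \<Longrightarrow> y \<in> A n \<Longrightarrow> ortho x y" "x \<in> B n \<Longrightarrow> y \<in> B n \<Longrightarrow> ortho x y"
    for n x y
    using spl [of n] by (auto simp: splitting_def)
  have step: "A n \<subseteq> A (Suc n)" "B n \<subseteq> B (Suc n)"
      "from_nat_into H n \<in> generate G (A (Suc n) \<union> B (Suc n) \<union> radical)" for n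
    using P(2) [of n] by (simp_all add: A_def B_def)
  have mono: "mono A" "mono B"
    using step by (auto simp: mono_iff_le_Suc)
  \<comment> \<open>The radical is orthogonal to all of \<open>H\<close>, so adding it to one side
    keeps that side pairwise orthogonal.\<close>
  define A' where "A' = (\<Union>n. A n) \<union> radical"
  define B' where "B' = (\<Union>n. B n)"
  have sub: "A' \<subseteq> H" "B' \<subseteq> H"
    using spl_sub by (auto simp: A'_def B'_def radical_def)
  \<comment> \<open>Two elements of an increasing union already lie in a common stage, where
    orthogonality is known.\<close>
  have chain: "\<exists>n. x \<in> S n \<and> y \<in> S n" if "mono S" "x \<in> \<Union> (range S)" "y \<in> \<Union> (range S)"
    for S :: "nat \<Rightarrow> 'a set" and x y
    using that by (metis UN_E max.cobounded1 max.cobounded2 monoD subsetD)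
  have ortho_A: "ortho x y" if "x \<in> A'" "y \<in> A'" for x y
  proof (cases "x \<in> radical \<or> y \<in> radical")
    case True
    then show ?thesis
      using that sub by (auto simp: radical_def intro: ortho_sym)
  next
    case False
    then show ?thesis
      using that chain [OF mono(1), of x y] spl_ortho(1) by (auto simp: A'_def)
  qed
  have ortho_B: "ortho x y" if "x \<in> B'" "y \<in> B'" for x y
    using that chain [OF mono(2), of x y] spl_ortho(2) by (auto simp: B'_def)
  let ?GA = "generate G A'" and ?GB = "generate G B'"
  have carr: "A' \<subseteq> carrier G" "B' \<subseteq> carrier G"
    using sub by auto
  have GAB: "?GA \<subseteq> H" "?GB \<subseteq> H"
    using sub by (simp_all add: generate_subset_subgroup H)
  have "generate G (?GA \<union> ?GB) = H"
  proof
    show "generate G (?GA \<union> ?GB) \<subseteq> H"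
      using GAB by (simp add: generate_subset_subgroup H)
    have "A (Suc n) \<union> B (Suc n) \<union> radical \<subseteq> ?GA \<union> ?GB" for n
      by (auto simp: A'_def B'_def intro!: generate.incl)
    then have "from_nat_into H n \<in> generate G (?GA \<union> ?GB)" for n
      using step(3) mono_generate by blast
    then show "H \<subseteq> generate G (?GA \<union> ?GB)"
      using range_H by (metis imageE subsetI)
  qed
  then show thesis
    using GAB carr ortho_generate [OF sub(1) ortho_A] ortho_generate [OF sub(2) ortho_B]
    by (intro that [of ?GA ?GB]) (auto simp: ortho_def generate_is_subgroup)
qed

end

section \<open>Induction on the order of \<open>M\<close>\<close>

lemma (in group) maximal_proper_subgroup:
  assumes M: "subgroup M G" "finite M" "M \<noteq> {\<one>}"
    and comm: "\<And>x y. x \<in> M \<Longrightarrow> y \<in> M \<Longrightarrow> x \<otimes> y = y \<otimes> x"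
  obtains N where "subgroup N G" "N \<subset> M"
    "\<And>u v. u \<in> M \<Longrightarrow> u \<notin> N \<Longrightarrow> v \<in> M \<Longrightarrow> \<exists>k::int. v \<otimes> u [^] k \<in> N"
proof -
  let ?F = "{N. subgroup N G \<and> N \<subset> M}"
  have "{\<one>} \<in> ?F"
    using M triv_subgroup subgroup.one_closed [OF M(1)] by auto
  moreover have "finite ?F"
    by (rule finite_subset [of _ "Pow M"]) (use M in auto)
  ultimately obtain N where N: "N \<in> ?F" and max: "\<And>K. K \<in> ?F \<Longrightarrow> N \<subseteq> K \<Longrightarrow> N = K"
    using finite_has_maximal [of ?F] by (metis (no_types, lifting) empty_iff)
  have Nsub: "subgroup N G" "N \<subseteq> M"
    using N by auto
  have Mc: "x \<in> carrier G" if "x \<in> M" for x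
    using subgroup.mem_carrier [OF M(1) that] .
  have "\<exists>k::int. v \<otimes> u [^] k \<in> N" if u: "u \<in> M" "u \<notin> N" and v: "v \<in> M" for u v
  proof -
    \<comment> \<open>\<open>?K\<close> is the product of \<open>N\<close> with the cyclic group of
      \<open>u\<close>. It contains \<open>N\<close> and the element \<open>u\<close> outside
      \<open>N\<close>, so by maximality it equals \<open>M\<close>, and membership of
      \<open>v\<close> provides the exponent.\<close>
    let ?K = "{x \<in> M. \<exists>k::int. x \<otimes> u [^] k \<in> N}"
    have pow: "u [^] k \<in> M" for k :: int
      using u M(1) by (simp add: subgroup_int_pow_closed)
    have "subgroup ?K G"
    proof
      fix x y assume xy: "x \<in> ?K" "y \<in> ?K"
      then obtain k l :: int where kl: "x \<otimes> u [^] k \<in> N" "y \<otimes> u [^] l \<in> N" and M': "x \<in> M" "y \<in> M"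
        by blast
      have "x \<otimes> u [^] k \<otimes> (y \<otimes> u [^] l) = x \<otimes> (u [^] k \<otimes> y) \<otimes> u [^] l"
        using M' u Mc by (simp add: m_assoc)
      also have "u [^] k \<otimes> y = y \<otimes> u [^] k"
        using M' pow comm by simp
      also have "x \<otimes> (y \<otimes> u [^] k) \<otimes> u [^] l = x \<otimes> y \<otimes> u [^] (k + l)"
        using M' u Mc by (simp add: m_assoc int_pow_mult)
      finally have "x \<otimes> y \<otimes> u [^] (k + l) \<in> N"
        using kl subgroup.m_closed [OF Nsub(1)] by metis
      then show "x \<otimes> y \<in> ?K"
        using M' subgroup.m_closed [OF M(1)] by blast
    next
      fix x assume "x \<in> ?K"
      then obtain k :: int where k: "x \<otimes> u [^] k \<in> N" and x: "x \<in> M"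
        by blast
      have "inv (x \<otimes> u [^] k) = inv (u [^] k \<otimes> x)"
        using comm x pow by simp
      also have "\<dots> = inv x \<otimes> u [^] (- k)"
        using x u Mc by (simp add: inv_mult_group int_pow_neg)
      finally have "inv x \<otimes> u [^] (- k) \<in> N"
        using k subgroup.m_inv_closed [OF Nsub(1)] by metis
      then show "inv x \<in> ?K"
        using x subgroup.m_inv_closed [OF M(1)] by blast
    next
      have "\<one> \<otimes> u [^] (0::int) \<in> N"
        using subgroup.one_closed [OF Nsub(1)] by simp
      then show "\<one> \<in> ?K"
        using subgroup.one_closed [OF M(1)] by blast
    qed (use Mc in auto)
    moreover have "N \<subseteq> ?K"
    proof
      fix x assume x: "x \<in> N"
      then have "x \<otimes> u [^] (0::int) \<in> N"
        using Nsub Mc by auto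
      then show "x \<in> ?K"
        using x Nsub by blast
    qed
    moreover have "u \<in> ?K"
    proof -
      have "u \<otimes> u [^] (- 1 :: int) \<in> N"
        using u Mc subgroup.one_closed [OF Nsub(1)] by (simp add: int_pow_neg)
      then show ?thesis using u by blast
    qed
    ultimately have "?K = M"
      using max [of ?K] u by blast
    then show ?thesis
      using v by blast
  qed
  then show thesis
    using that N by blast
qed

text \<open>Strong induction on \<open>card M\<close> with \<open>H\<close> varying: the two
  subgroups generating \<open>H\<close> have their commutators in a proper subgroup \<open>N\<close>
  of \<open>M\<close>, and the families found for them are united. For trivial \<open>M\<close>,
  \<open>H\<close> itself is abelian.\<close>

lemma (in central_commutators) finitely_many_abelian_subgroups:
  assumes "finite M" "countable H" "\<And>x y. x \<in> M \<Longrightarrow> y \<in> M \<Longrightarrow> x \<otimes> y = y \<otimes> x"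
  shows "\<exists>\<A>. finite \<A> \<and> (\<forall>A\<in>\<A>. abelian_subgroup A G) \<and> generate G (\<Union>\<A>) = H"
  using assms central_commutators_axioms
proof (induction "card M" arbitrary: H M rule: less_induct)
  case less
  interpret central_commutators G H M
    by (rule less.prems)
  show ?case
  proof (cases "M = {\<one>}")
    case True
    then have "abelian_subgroup H G"
      using H commutator_in by (intro abelian_subgroupI) (auto simp: commutator_eq_one_iff)
    moreover have "generate G H = H"
      using generate_subset_subgroup [OF H, of H] by (auto intro: generate.incl)
    ultimately show ?thesis
      by (intro exI [of _ "{H}"]) auto
  next
    case False
    obtain N where NM: "subgroup N G" "N \<subset> M"
      and max: "\<And>u v. u \<in> M \<Longrightarrow> u \<notin> N \<Longrightarrow> v \<in> M \<Longrightarrow> \<exists>k::int. v \<otimes> u [^] k \<in> N"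
      using maximal_proper_subgroup [OF M \<open>finite M\<close> False less.prems(3)] by blast
    interpret maximal_central_commutators G H M N
      by (intro maximal_central_commutators.intro maximal_central_commutators_axioms.intro
          central_commutators_axioms NM(1) psubset_imp_subset [OF NM(2)] max)
    obtain A B where AB: "subgroup A G" "subgroup B G" "A \<subseteq> H" "B \<subseteq> H" "generate G (A \<union> B) = H"
      "\<And>x y. x \<in> A \<Longrightarrow> y \<in> A \<Longrightarrow> commutator x y \<in> N"
      "\<And>x y. x \<in> B \<Longrightarrow> y \<in> B \<Longrightarrow> commutator x y \<in> N"
      using generated_by_two_subgroups [OF \<open>countable H\<close>] by blast
    have IH: "\<exists>\<A>. finite \<A> \<and> (\<forall>A\<in>\<A>. abelian_subgroup A G) \<and> generate G (\<Union>\<A>) = K"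
      if "subgroup K G" "K \<subseteq> H" "\<And>x y. x \<in> K \<Longrightarrow> y \<in> K \<Longrightarrow> commutator x y \<in> N" for K
    proof (rule less.hyps)
      show "card N < card M"
        using NM \<open>finite M\<close> by (simp add: psubset_card_mono)
      show "finite N"
        using NM \<open>finite M\<close> finite_subset by blast
      show "countable K"
        using \<open>countable H\<close> that countable_subset by blast
      show "central_commutators G K N"
      proof (intro central_commutators.intro central_commutators_axioms.intro)
        show "m \<otimes> x = x \<otimes> m" if "m \<in> N" "x \<in> K" for m x
          using that NM \<open>K \<subseteq> H\<close> central by blast
      qed (use that NM in \<open>simp_all add: is_group\<close>)
      show "x \<otimes> y = y \<otimes> x" if "x \<in> N" "y \<in> N" for x y
        using that NM less.prems(3) by blast
    qed
    obtain \<A> where \<A>: "finite \<A>" "\<forall>A\<in>\<A>. abelian_subgroup A G" "generate G (\<Union>\<A>) = A"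
      using IH AB by meson
    obtain \<B> where \<B>: "finite \<B>" "\<forall>A\<in>\<B>. abelian_subgroup A G" "generate G (\<Union>\<B>) = B"
      using IH AB by meson
    have "generate G (\<Union>(\<A> \<union> \<B>)) = H"
    proof
      have "\<Union>(\<A> \<union> \<B>) \<subseteq> A \<union> B"
        using \<A>(3) \<B>(3) generate.incl [of _ "\<Union>\<A>" G] generate.incl [of _ "\<Union>\<B>" G] by auto
      then show "generate G (\<Union>(\<A> \<union> \<B>)) \<subseteq> H"
        using AB mono_generate by metis
      have "\<Union>(\<A> \<union> \<B>) \<subseteq> carrier G"
        using \<open>\<Union>(\<A> \<union> \<B>) \<subseteq> A \<union> B\<close> AB(3,4) H_carrier by blast
      then have "subgroup (generate G (\<Union>(\<A> \<union> \<B>))) G"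
        by (rule generate_is_subgroup)
      moreover have "A \<union> B \<subseteq> generate G (\<Union>(\<A> \<union> \<B>))"
        using mono_generate [of "\<Union>\<A>" "\<Union>(\<A> \<union> \<B>)"] mono_generate [of "\<Union>\<B>" "\<Union>(\<A> \<union> \<B>)"] \<A>(3) \<B>(3)
        by auto
      ultimately show "H \<subseteq> generate G (\<Union>(\<A> \<union> \<B>))"
        using generate_subset_subgroup AB(5) by blast
    qed
    then show ?thesis
      using \<A> \<B> by (intro exI [of _ "\<A> \<union> \<B>"]) auto
  qed
qed

section \<open>Reduction to the centralizer of the derived subgroup\<close>

lemma (in group) centralizer_of_finite_normal:
  assumes "finite D" "D \<lhd> G"
  defines "C \<equiv> {x \<in> carrier G. \<forall>d\<in>D. d \<otimes> x = x \<otimes> d}"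
  obtains T where "subgroup C G" "finite T" "T \<subseteq> carrier G"
    "\<And>x. x \<in> carrier G \<Longrightarrow> \<exists>t\<in>T. inv t \<otimes> x \<in> C"
proof -
  interpret D: normal D G
    by (rule assms)
  have D [simp]: "d \<in> carrier G" if "d \<in> D" for d
    using D.subset that by blast
  have sub: "subgroup C G"
  proof
    fix x y assume "x \<in> C" "y \<in> C"
    then show "x \<otimes> y \<in> C"
      unfolding C_def by (auto simp flip: m_assoc) (auto simp: m_assoc)
  next
    fix x assume "x \<in> C"
    then have x: "x \<in> carrier G" "\<And>d. d \<in> D \<Longrightarrow> d \<otimes> x = x \<otimes> d"
      by (auto simp: C_def)
    have "d \<otimes> inv x = inv x \<otimes> d" if d: "d \<in> D" for d
    proof -
      have "inv x \<otimes> (d \<otimes> x) \<otimes> inv x = inv x \<otimes> (x \<otimes> d) \<otimes> inv x"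
        using x d by simp
      then show ?thesis
        using x(1) d by (simp add: m_assoc)
    qed
    then show "inv x \<in> C"
      using x by (simp add: C_def)
  qed (auto simp: C_def)
  \<comment> \<open>\<open>f x\<close> is conjugation by \<open>x\<close> on \<open>D\<close>,
    restricted to \<open>D\<close> so that it belongs to the finite set
    \<open>D \<rightarrow>\<^sub>E D\<close>. If \<open>f x = f t\<close>, then
    \<open>inv t \<otimes> x\<close> centralizes \<open>D\<close>, so a finite set \<open>T\<close>
    attaining every value of \<open>f\<close> suffices.\<close>
  define f where "f x = (\<lambda>d\<in>D. x \<otimes> d \<otimes> inv x)" for x
  have "f ` carrier G \<subseteq> D \<rightarrow>\<^sub>E D"
    using D.inv_op_closed2 by (auto simp: f_def)
  then have "finite (f ` carrier G)"
    using assms(1) finite_PiE finite_subset by metis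
  then obtain T where T: "T \<subseteq> carrier G" "finite T" "f ` carrier G = f ` T"
    using finite_subset_image [of "f ` carrier G" f "carrier G"] by auto
  have "\<exists>t\<in>T. inv t \<otimes> x \<in> C" if x: "x \<in> carrier G" for x
  proof -
    obtain t where t: "t \<in> T" "f x = f t"
      using T x by (metis imageE image_eqI)
    then have tc: "t \<in> carrier G"
      using T by blast
    have "d \<otimes> (inv t \<otimes> x) = inv t \<otimes> x \<otimes> d" if d: "d \<in> D" for d
    proof -
      have "x \<otimes> d \<otimes> inv x = t \<otimes> d \<otimes> inv t"
        using fun_cong [OF t(2), of d] d by (simp add: f_def)
      then have "inv t \<otimes> (x \<otimes> d \<otimes> inv x) \<otimes> x = inv t \<otimes> (t \<otimes> d \<otimes> inv t) \<otimes> x"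
        by simp
      then show ?thesis
        using x tc d by (simp add: m_assoc)
    qed
    then show ?thesis
      using t x tc by (auto simp: C_def)
  qed
  then show thesis
    using that sub T by blast
qed

theorem theorem2p2:
  fixes G :: "('a, 'b) monoid_scheme"
  assumes "group G"
    and "countable (carrier G)"
    and "finite_by_abelian G"
  shows "ab_gen_number G <o natLeq \<and>
    (\<exists>\<A>. finite \<A> \<and> (\<forall>A\<in>\<A>. abelian_subgroup A G) \<and> generate G (\<Union>\<A>) = carrier G)"
proof -
  interpret group G by fact
  let ?D = "derived G (carrier G)"
  have "finite ?D"
    using assms(3) by (simp add: finite_by_abelian_def)
  \<comment> \<open>The convention chosen for \<open>commutator\<close> is that of the generators of
    \<open>derived\<close>.\<close>
  have comm_D: "commutator x y \<in> ?D" if "x \<in> carrier G" "y \<in> carrier G" for x y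
    using that unfolding derived_def commutator_def by (intro generate.incl) blast
  have normal: "?D \<lhd> G"
    by (rule derived_self_is_normal)
  define C where "C = {x \<in> carrier G. \<forall>d\<in>?D. d \<otimes>\<^bsub>G\<^esub> x = x \<otimes>\<^bsub>G\<^esub> d}"
  obtain T where C: "subgroup C G" and T: "finite T" "T \<subseteq> carrier G"
    "\<And>x. x \<in> carrier G \<Longrightarrow> \<exists>t\<in>T. inv\<^bsub>G\<^esub> t \<otimes>\<^bsub>G\<^esub> x \<in> C"
    using centralizer_of_finite_normal [OF \<open>finite ?D\<close> normal, folded C_def] by blast
  interpret C: central_commutators G C "?D \<inter> C"
  proof (intro central_commutators.intro central_commutators_axioms.intro)
    show "subgroup (?D \<inter> C) G"
      using C normal by (intro subgroups_Inter_pair) (auto simp: normal_imp_subgroup)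
    show "commutator x y \<in> ?D \<inter> C" if "x \<in> C" "y \<in> C" for x y
      using that comm_D subgroup.m_closed [OF C] subgroup.m_inv_closed [OF C] subgroup.mem_carrier [OF C]
      by (auto simp: commutator_def)
    show "m \<otimes>\<^bsub>G\<^esub> x = x \<otimes>\<^bsub>G\<^esub> m" if "m \<in> ?D \<inter> C" "x \<in> C" for m x
      using that by (simp add: C_def)
  qed (use C in simp_all)
  have "countable C"
    by (rule countable_subset [OF subgroup.subset [OF C] assms(2)])
  moreover have "x \<otimes>\<^bsub>G\<^esub> y = y \<otimes>\<^bsub>G\<^esub> x" if "x \<in> ?D \<inter> C" "y \<in> ?D \<inter> C" for x y
    using that C.central by blast
  ultimately obtain \<A> where \<A>: "finite \<A>" "\<forall>A\<in>\<A>. abelian_subgroup A G" "generate G (\<Union>\<A>) = C"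
    using C.finitely_many_abelian_subgroups \<open>finite ?D\<close> by blast
  \<comment> \<open>The finite index of \<open>C\<close> is used here: one cyclic subgroup for each
    \<open>t\<close> in \<open>T\<close> makes up for passing from \<open>G\<close> to
    \<open>C\<close>.\<close>
  define \<B> where "\<B> = \<A> \<union> (\<lambda>t. generate G {t}) ` T"
  have fin: "finite \<B>"
    using \<A> T by (simp add: \<B>_def)
  have ab: "\<forall>A\<in>\<B>. abelian_subgroup A G"
    using \<A> T abelian_generating_cyclic by (auto simp: \<B>_def abelian_generating_def)
  have gen: "generate G (\<Union>\<B>) = carrier G"
  proof
    have *: "\<Union>\<B> \<subseteq> carrier G"
      using ab subgroup.subset by (fastforce simp: abelian_subgroup_def)
    then show "generate G (\<Union>\<B>) \<subseteq> carrier G"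
      by (rule generate_incl)
    have "C \<subseteq> generate G (\<Union>\<B>)"
      using mono_generate [of "\<Union>\<A>" "\<Union>\<B>"] \<A>(3) by (auto simp: \<B>_def)
    moreover have "T \<subseteq> generate G (\<Union>\<B>)"
      by (auto simp: \<B>_def intro!: generate.incl)
    ultimately have "generate G (C \<union> T) \<subseteq> generate G (\<Union>\<B>)"
      using generate_is_subgroup [OF *] by (intro generate_subset_subgroup) auto
    then show "carrier G \<subseteq> generate G (\<Union>\<B>)"
      using generate_subgroup_transversal [OF C T(2,3)] by simp
  qed
  \<comment> \<open>Since \<open>ab_gen_number\<close> is defined by choice, it is compared with the
    finite family through the attained minimum.\<close>
  obtain \<C> where "ab_gen_number G = |\<C>|" "\<And>\<B>. abelian_generating G \<B> \<Longrightarrow> |\<C>| \<le>o |\<B>|"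
    using ab_gen_number_attained by blast
  then have "ab_gen_number G \<le>o |\<B>|"
    using ab gen by (simp add: abelian_generating_def)
  also have "|\<B>| <o natLeq"
    using fin by (simp add: finite_iff_ordLess_natLeq [symmetric])
  finally show ?thesis
    using fin ab gen by blast
qed

end
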